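(* Let $K_1,\dots,K_m$ be strictly convex bodies in $\mathbb{R}^N$. Then the normal parametrization of the boundary of the Minkowski sum $K_1+\cdots+K_m$ is given by $$\mathbf x_{\partial(K_1+\cdots+K_m)}(\mathbf n)=\mathbf x_{\partial K_1}(\mathbf n)+\cdots+\mathbf x_{\partial K_m}(\mathbf n),\qquad \mathbf n\in\mathbb{S}^{N-1}.$$
   Context: A body is a bounded, connected, open, nonempty subset of $\mathbb{R}^N$. The Minkowski sum is $B_1+B_2=\{\mathbf x+\mathbf y:\mathbf x\in B_1,\ \mathbf y\in B_2\}$. A convex body $K$ is strictly convex if for all pairs of distinct points $\mathbf x,\mathbf y\in\partial K$ the open line segment $\{t\mathbf x+(1-t)\mathbf y:0<t<1\}$ is contained in $K$. The support function of a convex body $K$ is $h_K(\mathbf v)=\sup_{\mathbf x\in K}\mathbf x\cdot\mathbf v$, $\mathbf v\in\mathbb{R}^N$. For a strictly convex body $K$ and $\mathbf n\in\mathbb{S}^{N-1}$ (the unit sphere) there is a unique $\mathbf x\in\partial K$ with $h_K(\mathbf n)=\mathbf x\cdot\mathbf n$; this point is denoted $\mathbf x_{\partial K}(\mathbf n)$, and the map $\mathbf x_{\partial K}:\mathbb{S}^{N-1}\to\partial K$ is called the normal parametrization of $\partial K$. *)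

theory Defs
  imports "HOL-Analysis.Analysis"
begin

text \<open>
  Minkowski sums are the pointwise sums of sets of \<open>HOL-Library.Set_Algebras\<close>, which
  \<open>HOL-Analysis\<close> already loads: \<open>A + B = {c. \<exists>a\<in>A. \<exists>b\<in>B. c = a + b}\<close>. Sets over a commutative
  monoid form a commutative monoid under this operation, so that \<open>\<Sum>i = 1..m. K i\<close> denotes the
  iterated Minkowski sum. The empty sum is \<open>{0}\<close>.
\<close>

definition body :: "(real ^ 'n) set \<Rightarrow> bool" where
  "body B \<longleftrightarrow> bounded B \<and> connected B \<and> open B \<and> B \<noteq> {}"

definition convex_body :: "(real ^ 'n) set \<Rightarrow> bool" where
  "convex_body K \<longleftrightarrow> body K \<and> convex K"

definition strictly_convex_body :: "(real ^ 'n) set \<Rightarrow> bool" where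
  "strictly_convex_body K \<longleftrightarrow>
     convex_body K \<and>
     (\<forall>x\<in>frontier K. \<forall>y\<in>frontier K. x \<noteq> y \<longrightarrow> open_segment x y \<subseteq> K)"

text \<open>The supremum is taken in \<open>real\<close>, so it is meaningful only for bounded nonempty \<open>K\<close>.\<close>

definition support_function :: "(real ^ 'n) set \<Rightarrow> real ^ 'n \<Rightarrow> real" where
  "support_function K v = (SUP x\<in>K. x \<bullet> v)"

text \<open>
  The description is well-defined when \<open>K\<close> is a strictly convex body and \<open>n\<close> is a unit vector;
  it carries no information otherwise.
\<close>

definition normal_parametrization :: "(real ^ 'n) set \<Rightarrow> real ^ 'n \<Rightarrow> real ^ 'n" where
  "normal_parametrization K n =
     (THE x. x \<in> frontier K \<and> support_function K n = x \<bullet> n)"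

end

theory Submission
  imports Defs
begin

text \<open>
  For a nonzero direction \<open>n\<close>, the point of \<open>\<partial>K\<close> on which \<open>n\<close> is an outward normal is the
  maximizer of the linear functional \<open>x \<mapsto> x \<bullet> n\<close> over the closure of \<open>K\<close>. Maximizing a linear
  functional over a Minkowski sum decouples into maximizing it over each summand, so the sum of
  the maximizers for \<open>A\<close> and \<open>B\<close> is a maximizer for \<open>A + B\<close>
  (\<open>normal_parametrization_plus\<close>). Identifying it as \<^emph>\<open>the\<close> maximizer needs uniqueness, and
  hence that \<open>A + B\<close> is again strictly convex (\<open>strictly_convex_body_plus\<close>).

  Strict convexity passes to sums because it can be tested on the closure instead of the boundary:
  any two distinct points of the closure of \<open>K\<close> span an open segment inside \<open>K\<close>
  (\<open>open_segment_subset_strictly_convex_body\<close>). Points \<open>p \<noteq> q\<close> of the closure of \<open>A + B\<close> split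
  as \<open>a + b\<close> and \<open>a' + b'\<close> over the closures of \<open>A\<close> and \<open>B\<close>, and one of \<open>a \<noteq> a'\<close>, \<open>b \<noteq> b'\<close>
  holds. An intermediate point of \<open>p\<close> and \<open>q\<close> therefore has one component in the open set itself,
  which absorbs the fact that the other component is only known to lie in a closure
  (\<open>open_plus_closure_subset\<close>). The general case follows by induction on the number of summands.
\<close>

section \<open>Strict convexity of Minkowski sums\<close>

lemma strictly_convex_bodyD:
  assumes "strictly_convex_body K"
  shows "bounded K" "open K" "K \<noteq> {}" "convex K"
  using assms by (auto simp: strictly_convex_body_def convex_body_def body_def)

text \<open>
  If one endpoint is interior, convexity alone suffices; the strict hypothesis covers the
  remaining case of two boundary points.
\<close>

lemma open_segment_subset_strictly_convex_body:
  assumes K: "strictly_convex_body K"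
    and "x \<in> closure K" "y \<in> closure K" "x \<noteq> y"
  shows "open_segment x y \<subseteq> K"
proof -
  note K' = strictly_convex_bodyD[OF K]
  consider "x \<in> K" | "y \<in> K" | "x \<in> frontier K" "y \<in> frontier K"
    using assms K' by (auto simp: frontier_def interior_open)
  then show ?thesis
  proof cases
    case 1
    then show ?thesis
      using in_interior_closure_convex_segment[of K x y] assms K' by (simp add: interior_open)
  next
    case 2
    then show ?thesis
      using in_interior_closure_convex_segment[of K y x] assms K'
      by (simp add: interior_open open_segment_commute)
  next
    case 3
    then show ?thesis
      using K \<open>x \<noteq> y\<close> by (auto simp: strictly_convex_body_def)
  qed
qed

text \<open>
  A point of the closure of \<open>B\<close> can be moved into \<open>B\<close> by a small displacement, which the
  summand in the open set \<open>A\<close> compensates.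
\<close>

lemma open_plus_closure_subset:
  fixes A B :: "'a::real_normed_vector set"
  assumes "open A"
  shows "A + closure B \<subseteq> A + B"
proof
  fix z assume "z \<in> A + closure B"
  then obtain a b where a: "a \<in> A" and b: "b \<in> closure B" and z: "z = a + b"
    by (auto elim: set_plus_elim)
  obtain e where "e > 0" and e: "ball a e \<subseteq> A"
    using assms a open_contains_ball by blast
  obtain b' where b': "b' \<in> B" "dist b' b < e"
    using b \<open>e > 0\<close> closure_approachable by blast
  have "a + (b - b') \<in> A"
    using e b'(2) by (auto simp: subset_iff dist_norm norm_minus_commute)
  then have "(a + (b - b')) + b' \<in> A + B"
    using b'(1) by (rule set_plus_intro)
  then show "z \<in> A + B"
    by (simp add: z)
qed

lemma open_segment_sum_decompose:
  fixes a b a' b' :: "'a::real_vector"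
  assumes z: "z \<in> open_segment (a + b) (a' + b')" and "a \<noteq> a'"
  obtains u v where "u \<in> open_segment a a'" "v \<in> closed_segment b b'" "z = u + v"
proof -
  obtain t where t: "0 < t" "t < 1" and zt: "z = (1 - t) *\<^sub>R (a + b) + t *\<^sub>R (a' + b')"
    using z by (auto simp: in_segment)
  show thesis
  proof
    show "(1 - t) *\<^sub>R a + t *\<^sub>R a' \<in> open_segment a a'"
      using t \<open>a \<noteq> a'\<close> by (auto simp: in_segment)
    show "(1 - t) *\<^sub>R b + t *\<^sub>R b' \<in> closed_segment b b'"
      using t by (auto simp: in_segment intro!: exI[of _ t])
    show "z = ((1 - t) *\<^sub>R a + t *\<^sub>R a') + ((1 - t) *\<^sub>R b + t *\<^sub>R b')"
      by (simp add: zt algebra_simps)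
  qed
qed

text \<open>
  The two components of the splitting play symmetric roles; this is the half in which the
  components in \<open>A\<close> differ.
\<close>

lemma open_segment_subset_plus:
  assumes A: "strictly_convex_body A" and B: "strictly_convex_body B"
    and "a \<in> closure A" "a' \<in> closure A" "b \<in> closure B" "b' \<in> closure B" "a \<noteq> a'"
  shows "open_segment (a + b) (a' + b') \<subseteq> A + B"
proof
  fix z assume "z \<in> open_segment (a + b) (a' + b')"
  then obtain u v where u: "u \<in> open_segment a a'" and v: "v \<in> closed_segment b b'"
    and z: "z = u + v"
    using open_segment_sum_decompose \<open>a \<noteq> a'\<close> by metis
  have "u \<in> A"
    using open_segment_subset_strictly_convex_body[OF A] assms u by blast
  moreover have "v \<in> closure B"
    using closed_segment_subset[of b "closure B" b'] v assms strictly_convex_bodyD(4)[OF B]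
    by (auto simp: convex_closure)
  ultimately show "z \<in> A + B"
    using open_plus_closure_subset[of A B] strictly_convex_bodyD(2)[OF A] z by blast
qed

lemma strictly_convex_body_plus:
  fixes A B :: "(real ^ 'n) set"
  assumes A: "strictly_convex_body A" and B: "strictly_convex_body B"
  shows "strictly_convex_body (A + B)"
proof -
  note A' = strictly_convex_bodyD[OF A] and B' = strictly_convex_bodyD[OF B]
  have sums: "S + T = (\<Union>a\<in>S. \<Union>b\<in>T. {a + b})" for S T :: "(real ^ 'n) set"
    by (auto simp: set_plus_def)
  have "bounded (A + B)"
    unfolding sums by (rule bounded_sums[OF A'(1) B'(1)])
  moreover have "open (A + B)"
    unfolding sums by (rule open_sums) (use A' in simp)
  moreover have "convex (A + B)"
    by (rule convex_set_plus[OF A'(4) B'(4)])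
  moreover have "A + B \<noteq> {}"
    using A'(3) B'(3) by (auto simp: set_plus_def)
  ultimately have "convex_body (A + B)"
    by (simp add: convex_body_def body_def convex_connected)
  moreover have "open_segment p q \<subseteq> A + B"
    if pq: "p \<in> frontier (A + B)" "q \<in> frontier (A + B)" and "p \<noteq> q" for p q
  proof -
    \<comment> \<open>Boundedness makes the sum of the closures compact, so boundary points split.\<close>
    have "compact (closure A + closure B)"
      unfolding sums by (rule compact_sums') (use A' B' in simp_all)
    then have "closure (A + B) \<subseteq> closure A + closure B"
      by (intro closure_minimal set_plus_mono2 closure_subset compact_imp_closed)
    then obtain a b a' b' where ab: "a \<in> closure A" "b \<in> closure B" "a' \<in> closure A"
        "b' \<in> closure B" "p = a + b" "q = a' + b'"
      using pq unfolding frontier_def by (blast elim: set_plus_elim)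
    show ?thesis
    proof (cases "a = a'")
      case False
      then show ?thesis
        using open_segment_subset_plus[OF A B] ab by blast
    next
      case True
      then have "b \<noteq> b'"
        using \<open>p \<noteq> q\<close> ab by blast
      then have "open_segment (b + a) (b' + a') \<subseteq> B + A"
        using open_segment_subset_plus[OF B A] ab by blast
      then show ?thesis
        using ab by (simp add: add.commute)
    qed
  qed
  ultimately show ?thesis
    by (simp add: strictly_convex_body_def)
qed

section \<open>Boundary points as maximizers of linear functionals\<close>

lemma inner_le_on_closure:
  assumes "\<And>y. y \<in> K \<Longrightarrow> y \<bullet> n \<le> c" and "x \<in> closure K"
  shows "x \<bullet> n \<le> c"
proof -
  have "closed {y. y \<bullet> n \<le> c}"
    by (simp add: inner_commute[of _ n] closed_halfspace_le)
  then have "closure K \<subseteq> {y. y \<bullet> n \<le> c}"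
    using assms(1) by (intro closure_minimal) auto
  then show ?thesis
    using assms(2) by blast
qed

text \<open>From a point of an open set, a small step along \<open>n\<close> increases the functional.\<close>

lemma exists_larger_inner_in_open:
  fixes n :: "'a::real_inner"
  assumes "open K" "x \<in> K" "n \<noteq> 0"
  obtains y where "y \<in> K" "x \<bullet> n < y \<bullet> n"
proof -
  obtain e where "e > 0" and e: "cball x e \<subseteq> K"
    using assms open_contains_cball by blast
  show thesis
  proof
    show "x + (e / norm n) *\<^sub>R n \<in> K"
      using e \<open>e > 0\<close> \<open>n \<noteq> 0\<close> by (auto simp: subset_iff dist_norm)
    show "x \<bullet> n < (x + (e / norm n) *\<^sub>R n) \<bullet> n"
      using \<open>e > 0\<close> \<open>n \<noteq> 0\<close> by (simp add: inner_add_left)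
  qed
qed

text \<open>
  This removes the supremum and the boundary from the description: a maximizer over the closure
  is automatically a boundary point because an open set contains no maximizer.
\<close>

lemma frontier_support_function_iff:
  assumes K: "bounded K" "open K" "K \<noteq> {}" and "n \<noteq> 0"
  shows "x \<in> frontier K \<and> support_function K n = x \<bullet> n \<longleftrightarrow>
         x \<in> closure K \<and> (\<forall>y\<in>K. y \<bullet> n \<le> x \<bullet> n)"
proof -
  have "bounded ((\<lambda>y. y \<bullet> n) ` K)"
    using K(1) bounded_linear_image bounded_linear_inner_left by blast
  then have bdd: "bdd_above ((\<lambda>y. y \<bullet> n) ` K)"
    by (rule bounded_imp_bdd_above)
  then have upper: "y \<bullet> n \<le> support_function K n" if "y \<in> K" for y
    unfolding support_function_def using that by (rule cSUP_upper2) simp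
  show ?thesis
  proof
    assume "x \<in> frontier K \<and> support_function K n = x \<bullet> n"
    then show "x \<in> closure K \<and> (\<forall>y\<in>K. y \<bullet> n \<le> x \<bullet> n)"
      using upper by (auto simp: frontier_def)
  next
    assume x: "x \<in> closure K \<and> (\<forall>y\<in>K. y \<bullet> n \<le> x \<bullet> n)"
    then have "x \<notin> K"
      using exists_larger_inner_in_open[OF K(2) _ \<open>n \<noteq> 0\<close>] by (metis not_less)
    moreover have "support_function K n \<le> x \<bullet> n"
      unfolding support_function_def using x K(3) by (intro cSUP_least) auto
    moreover have "x \<bullet> n \<le> support_function K n"
      using inner_le_on_closure[of K n] upper x by blast
    ultimately show "x \<in> frontier K \<and> support_function K n = x \<bullet> n"
      using x K(2) by (auto simp: frontier_def interior_open)
  qed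
qed

text \<open>
  Uniqueness is where strict convexity enters: the midpoint of two distinct maximizers would be a
  maximizer inside the open set \<open>K\<close>.
\<close>

lemma maximizer_on_closure_unique:
  assumes K: "strictly_convex_body K" and "n \<noteq> 0"
    and x: "x \<in> closure K" "\<forall>z\<in>K. z \<bullet> n \<le> x \<bullet> n"
    and y: "y \<in> closure K" "\<forall>z\<in>K. z \<bullet> n \<le> y \<bullet> n"
  shows "x = y"
proof (rule ccontr)
  assume "x \<noteq> y"
  then have "midpoint x y \<in> K"
    using open_segment_subset_strictly_convex_body[OF K x(1) y(1)] by auto
  then obtain z where "z \<in> K" "midpoint x y \<bullet> n < z \<bullet> n"
    using exists_larger_inner_in_open strictly_convex_bodyD(2)[OF K] \<open>n \<noteq> 0\<close> by metis
  then have "midpoint x y \<bullet> n < x \<bullet> n" "midpoint x y \<bullet> n < y \<bullet> n"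
    using x(2) y(2) by fastforce+
  then show False
    by (simp add: midpoint_def inner_add_left)
qed

lemma normal_parametrization_eqI:
  assumes K: "strictly_convex_body K" and "n \<noteq> 0"
    and x: "x \<in> closure K" "\<forall>y\<in>K. y \<bullet> n \<le> x \<bullet> n"
  shows "normal_parametrization K n = x"
proof -
  note iff = frontier_support_function_iff[OF strictly_convex_bodyD(1-3)[OF K] \<open>n \<noteq> 0\<close>]
  show ?thesis
    unfolding normal_parametrization_def iff
    using x maximizer_on_closure_unique[OF K \<open>n \<noteq> 0\<close>] by (intro the_equality) blast+
qed

text \<open>Existence of the maximizer is compactness of the closure.\<close>

lemma normal_parametrization_maximizes:
  assumes K: "strictly_convex_body K" and "n \<noteq> 0"
  shows "normal_parametrization K n \<in> closure K"
    and "\<And>y. y \<in> K \<Longrightarrow> y \<bullet> n \<le> normal_parametrization K n \<bullet> n"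
proof -
  note K' = strictly_convex_bodyD[OF K]
  have "compact (closure K)" "closure K \<noteq> {}"
    using K' by auto
  moreover have "continuous_on (closure K) (\<lambda>y. y \<bullet> n)"
    by (intro continuous_intros)
  ultimately obtain x where x: "x \<in> closure K" "\<forall>y\<in>closure K. y \<bullet> n \<le> x \<bullet> n"
    using continuous_attains_sup by metis
  then have max: "\<forall>y\<in>K. y \<bullet> n \<le> x \<bullet> n"
    using closure_subset by blast
  have "normal_parametrization K n = x"
    by (rule normal_parametrization_eqI[OF K \<open>n \<noteq> 0\<close> x(1) max])
  then show "normal_parametrization K n \<in> closure K"
    and "\<And>y. y \<in> K \<Longrightarrow> y \<bullet> n \<le> normal_parametrization K n \<bullet> n"
    using x(1) max by auto
qed

section \<open>Additivity of the normal parametrization\<close>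

text \<open>
  Adding the inequalities \<open>a \<bullet> n \<le> x\<^sub>A \<bullet> n\<close> and \<open>b \<bullet> n \<le> x\<^sub>B \<bullet> n\<close> for the two maximizers shows
  that \<open>x\<^sub>A + x\<^sub>B\<close> is maximal over \<open>A + B\<close>.
\<close>

lemma normal_parametrization_plus:
  assumes A: "strictly_convex_body A" and B: "strictly_convex_body B" and "n \<noteq> 0"
  shows "normal_parametrization (A + B) n =
         normal_parametrization A n + normal_parametrization B n"
proof (rule normal_parametrization_eqI[OF strictly_convex_body_plus[OF A B] \<open>n \<noteq> 0\<close>])
  note maxA = normal_parametrization_maximizes[OF A \<open>n \<noteq> 0\<close>]
    and maxB = normal_parametrization_maximizes[OF B \<open>n \<noteq> 0\<close>]
  show "normal_parametrization A n + normal_parametrization B n \<in> closure (A + B)"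
    using maxA(1) maxB(1) closure_sum[of A B] by blast
  show "\<forall>y\<in>A + B. y \<bullet> n \<le> (normal_parametrization A n + normal_parametrization B n) \<bullet> n"
    using maxA(2) maxB(2) by (auto elim!: set_plus_elim simp: inner_add_left intro!: add_mono)
qed

text \<open>
  The induction starts at one summand, since the empty sum \<open>{0}\<close> is not open and hence not a body.
\<close>

theorem theorem2p4:
  fixes K :: "nat \<Rightarrow> (real ^ 'n) set" and m :: nat
  assumes "m \<ge> 1"
    and "\<And>i. i \<in> {1..m} \<Longrightarrow> strictly_convex_body (K i)"
  shows "strictly_convex_body (\<Sum>i = 1..m. K i) \<and>
    (\<forall>n \<in> sphere 0 1.
      normal_parametrization (\<Sum>i = 1..m. K i) n =
      (\<Sum>i = 1..m. normal_parametrization (K i) n))"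
  using assms
proof (induction m rule: nat_induct_at_least)
  case base
  then show ?case by simp
next
  case (Suc m)
  let ?S = "\<Sum>i = 1..m. K i"
  have S: "strictly_convex_body ?S"
    and IH: "\<forall>n \<in> sphere 0 1. normal_parametrization ?S n =
      (\<Sum>i = 1..m. normal_parametrization (K i) n)"
    using Suc by auto
  have KS: "strictly_convex_body (K (Suc m))"
    using Suc.prems by simp
  have "normal_parametrization (?S + K (Suc m)) n =
      (\<Sum>i = 1..m. normal_parametrization (K i) n) + normal_parametrization (K (Suc m)) n"
    if "n \<in> sphere 0 1" for n
  proof -
    have "n \<noteq> 0"
      using that by auto
    then show ?thesis
      using normal_parametrization_plus[OF S KS] IH that by simp
  qed
  then show ?case
    using strictly_convex_body_plus[OF S KS] by simp
qed

end
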